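(* Let $n>1$ and $s$ be nonnegative integers such that $n\equiv 1\pmod 3$ and $s\leq (n-4)/6$. Then $$\sum_{k=s}^{(2n+1)/3+s}[6k-1]\frac{(q^{-1};q^3)_{k-s}(q^{-1};q^3)_{k+s}(q^{-1};q^3)_{k}}{(q^{3};q^3)_{k-s}(q^{3};q^3)_{k+s}(q^{3};q^3)_{k}}q^{3k}\equiv 0\pmod{\Phi_n(q)^3}.$$
   Context: Here $q$ is an indeterminate. For a nonnegative integer $m$, $(x;q^3)_m=\prod_{j=0}^{m-1}(1-xq^{3j})$ (with $(x;q^3)_0=1$). For an integer $r$ (possibly negative), $[r]=(1-q^r)/(1-q)$ is the $q$-integer. $\Phi_n(q)=\prod_{1\le k\le n,\ \gcd(k,n)=1}(q-\zeta^k)$, with $\zeta$ a primitive $n$-th root of unity, is the $n$-th cyclotomic polynomial in $q$. Congruences are between rational functions of $q$: for a rational function $A(q)\in\mathbb{Q}(q)$ and a polynomial $P(q)$, $A(q)\equiv 0\pmod{P(q)}$ means that $A(q)=P(q)N(q)/D(q)$ with $N,D\in\mathbb{Q}[q]$ and $D$ relatively prime to $P$. *)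

theory Defs
  imports
    Complex_Main
    "HOL-Computational_Algebra.Computational_Algebra"
    "HOL-Number_Theory.Number_Theory"
begin

type_synonym ratfun = "rat poly fract"

definition qvar :: ratfun where
  "qvar = to_fract [:0, 1:]"

definition q_int :: "int \<Rightarrow> ratfun" where
  "q_int r = (1 - qvar powi r) / (1 - qvar)"

definition q3_poch :: "ratfun \<Rightarrow> nat \<Rightarrow> ratfun" where
  "q3_poch x m = (\<Prod>j<m. 1 - x * qvar ^ (3 * j))"

text \<open>
  The product over the primitive roots of unity lives in the polynomial ring over the complex
  numbers; \<open>map_poly_cyclotomic\<close> below shows that it has rational coefficients, so that
  \<open>cyclotomic\<close> is well defined. The index set \<^term>\<open>totatives n\<close> consists of the numbers
  from 1 to \<open>n\<close> that are coprime to \<open>n\<close>.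
\<close>

definition cyclotomic_complex :: "nat \<Rightarrow> complex poly" where
  "cyclotomic_complex n = (\<Prod>k\<in>totatives n. [:- (cis (2 * pi / real n) ^ k), 1:])"

definition cyclotomic :: "nat \<Rightarrow> rat poly" where
  "cyclotomic n = (THE p. map_poly of_rat p = cyclotomic_complex n)"

text \<open>
  Divisibility in the localisation of the polynomial ring at \<open>P\<close>. The condition \<open>D \<noteq> 0\<close> only
  matters for constant \<open>P\<close>, where \<open>D = 0\<close> would be coprime to \<open>P\<close>.
\<close>

definition ratfun_cong_0 :: "ratfun \<Rightarrow> rat poly \<Rightarrow> bool" where
  "ratfun_cong_0 A P \<longleftrightarrow>
     (\<exists>N D. D \<noteq> 0 \<and> coprime D P \<and> A = to_fract P * to_fract N / to_fract D)"


subsection \<open>Rationality of the cyclotomic polynomials\<close>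

lemma map_poly_of_rat_add:
  "map_poly (of_rat :: rat \<Rightarrow> complex) (p + q) = map_poly of_rat p + map_poly of_rat q"
  by (intro poly_eqI) (simp add: coeff_map_poly of_rat_add)

lemma map_poly_of_rat_mult:
  "map_poly (of_rat :: rat \<Rightarrow> complex) (p * q) = map_poly of_rat p * map_poly of_rat q"
  by (intro poly_eqI) (simp add: coeff_map_poly coeff_mult of_rat_sum of_rat_mult)

lemma inj_map_poly_of_rat: "inj (map_poly (of_rat :: rat \<Rightarrow> complex))"
proof (rule injI)
  fix p q :: "rat poly"
  assume eq: "map_poly (of_rat :: rat \<Rightarrow> complex) p = map_poly of_rat q"
  show "p = q"
  proof (rule poly_eqI)
    fix i
    have "poly.coeff (map_poly (of_rat :: rat \<Rightarrow> complex) p) i = poly.coeff (map_poly of_rat q) i"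
      by (simp only: eq)
    thus "poly.coeff p i = poly.coeff q i" by (simp add: coeff_map_poly)
  qed
qed

lemma cis_power_div: "cis (2 * pi / real n) ^ k = cis (2 * pi * real k / real n)"
  by (simp add: DeMoivre mult_ac)

lemma degree_prod_linear:
  "finite A \<Longrightarrow> degree (\<Prod>k\<in>A. [:- f k, 1 :: complex:]) = card A"
  by (subst degree_prod_eq_sum_degree) auto

lemma monic_prod_linear: "lead_coeff (\<Prod>k\<in>A. [:- f k, 1 :: complex:]) = 1"
  by (simp add: lead_coeff_prod)

lemma cis_root_image:
  assumes "n > 0"
  shows "bij_betw (\<lambda>k. cis (2 * pi * real k / real n)) {0<..n} {z. z ^ n = 1}"
proof -
  let ?f = "\<lambda>k. cis (2 * pi * real k / real n)"
  have "bij_betw (\<lambda>k. if k = n then 0 else k) {0<..n} {..<n}"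
    by (rule bij_betw_byWitness[where f' = "\<lambda>k. if k = 0 then n else k"]) (use assms in auto)
  hence "bij_betw (?f \<circ> (\<lambda>k. if k = n then 0 else k)) {0<..n} {z. z ^ n = 1}"
    using bij_betw_roots_unity[OF assms] by (rule bij_betw_trans)
  moreover have "bij_betw (?f \<circ> (\<lambda>k. if k = n then 0 else k)) {0<..n} {z. z ^ n = 1} \<longleftrightarrow>
    bij_betw ?f {0<..n} {z. z ^ n = 1}"
    by (rule bij_betw_cong) (use assms in auto)
  ultimately show ?thesis by simp
qed

lemma prod_roots_unity:
  assumes "n > 0"
  shows "(\<Prod>k\<in>{0<..n}. [:- cis (2 * pi * real k / real n), 1:]) = Polynomial.monom 1 n - 1"
    (is "?P = ?Q")
proof (rule ccontr)
  assume ne: "?P \<noteq> ?Q"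
  have degP: "degree ?P = n" and cP: "lead_coeff ?P = 1"
    by (subst degree_prod_linear, simp_all) (rule monic_prod_linear)
  have degQ: "degree ?Q \<le> n"
    by (intro degree_diff_le degree_monom_le) auto
  have "poly.coeff (?P - ?Q) n = 0"
    using assms cP by (simp add: degP)
  moreover have "degree (?P - ?Q) \<le> n"
    by (rule degree_diff_le[OF eq_refl[OF degP] degQ])
  ultimately have deg: "degree (?P - ?Q) < n"
    using ne by (metis le_neq_implies_less leading_coeff_0_iff right_minus_eq)
  have "z \<in> {z. poly (?P - ?Q) z = 0}" if "z ^ n = 1" for z
  proof -
    have "z \<in> (\<lambda>k. cis (2 * pi * real k / real n)) ` {0<..n}"
      unfolding bij_betw_imp_surj_on[OF cis_root_image[OF assms]] using that by simp
    then obtain k where "k \<in> {0<..n}" "z = cis (2 * pi * real k / real n)" by blast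
    hence "poly ?P z = 0" by (force simp: poly_prod)
    thus ?thesis using that by (simp add: poly_monom)
  qed
  hence "card {z::complex. z ^ n = 1} \<le> card {z. poly (?P - ?Q) z = 0}"
    by (intro card_mono poly_roots_finite) (use ne in auto)
  also have "\<dots> \<le> degree (?P - ?Q)"
    by (intro card_poly_roots_bound) (use ne in auto)
  finally show False using deg card_roots_unity_eq[OF assms] by simp
qed

lemma prod_cyclotomic_complex:
  assumes "n > 0"
  shows "(\<Prod>d | d dvd n. cyclotomic_complex d) = Polynomial.monom 1 n - 1"
proof -
  let ?f = "\<lambda>k. [:- cis (2 * pi * real k / real n), 1:]"
  have "Polynomial.monom 1 n - 1 = (\<Prod>k\<in>{0<..n}. ?f k)"
    using prod_roots_unity[OF assms] by simp
  also have "\<dots> = (\<Prod>d | d dvd n. \<Prod>k | k \<in> {0<..n} \<and> gcd k n = d. ?f k)"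
    by (rule prod.group[symmetric]) (use assms in auto)
  also have "\<dots> = (\<Prod>d | d dvd n. cyclotomic_complex (n div d))"
  proof (rule prod.cong)
    fix d assume "d \<in> {d. d dvd n}"
    hence d: "d dvd n" "d > 0" using assms by (auto intro: Nat.gr0I)
    have "(\<Prod>k | k \<in> {0<..n} \<and> gcd k n = d. ?f k) = (\<Prod>k\<in>totatives (n div d). ?f (k * d))"
      using prod.reindex_bij_betw[OF bij_betw_totatives_gcd_eq[OF d(1) assms], of ?f] by simp
    also have "\<dots> = cyclotomic_complex (n div d)"
      unfolding cyclotomic_complex_def cis_power_div
      using d assms by (intro prod.cong) (auto simp: real_of_nat_div field_simps)
    finally show "(\<Prod>k | k \<in> {0<..n} \<and> gcd k n = d. ?f k) = cyclotomic_complex (n div d)" .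
  qed simp
  also have "\<dots> = (\<Prod>d | d dvd n. cyclotomic_complex d)"
    by (rule prod.reindex_bij_witness[of _ "\<lambda>d. n div d" "\<lambda>d. n div d"]) (use assms in auto)
  finally show ?thesis by simp
qed

lemma monic_cyclotomic_complex: "lead_coeff (cyclotomic_complex n) = 1"
  unfolding cyclotomic_complex_def by (rule monic_prod_linear)

lemma degree_map_of_rat: "degree (map_poly (of_rat :: rat \<Rightarrow> complex) p) = degree p"
  by (rule degree_map_poly) auto

lemma rational_cyclotomic:
  assumes "n > 0"
  shows "\<exists>p. map_poly of_rat p = cyclotomic_complex n"
  using assms
proof (induction n rule: less_induct)
  case (less n)
  have "\<exists>p. map_poly of_rat p = cyclotomic_complex d" if "d dvd n \<and> d \<noteq> n" for d
    using less.IH[of d] less.prems that by (metis dvd_imp_le dvd_pos_nat le_neq_implies_less)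
  then obtain c where c: "\<And>d. d dvd n \<and> d \<noteq> n \<Longrightarrow> map_poly of_rat (c d) = cyclotomic_complex d"
    by metis
  let ?h = "map_poly (of_rat :: rat \<Rightarrow> complex)"
  define S where "S = {d. d dvd n \<and> d \<noteq> n}"
  have [simp]: "finite S" unfolding S_def
    by (rule finite_subset[of _ "{d. d dvd n}"]) (use less.prems in auto)
  define Q where "Q = (\<Prod>d\<in>S. c d)"
  have "?h (\<Prod>d\<in>S. c d) = (\<Prod>d\<in>S. ?h (c d))"
    using \<open>finite S\<close> by (induction S) (simp_all add: map_poly_of_rat_mult)
  also have "\<dots> = (\<Prod>d\<in>S. cyclotomic_complex d)"
    by (rule prod.cong) (simp_all add: S_def c)
  finally have hQ: "?h Q = (\<Prod>d\<in>S. cyclotomic_complex d)"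
    by (simp only: Q_def)
  have Q0: "Q \<noteq> 0"
  proof
    assume "Q = 0"
    hence "(\<Prod>d\<in>S. cyclotomic_complex d) = 0" using hQ by simp
    then obtain d where "cyclotomic_complex d = 0"
      using \<open>finite S\<close> by (auto simp: prod_zero_iff)
    thus False using monic_cyclotomic_complex[of d] by simp
  qed
  define R :: "rat poly" where "R = Polynomial.monom 1 n - 1"
  have hR: "?h R = Polynomial.monom 1 n - 1"
    unfolding R_def by (intro poly_eqI) (auto simp: coeff_map_poly of_rat_diff)
  have "{d. d dvd n} = insert n S" "n \<notin> S" by (auto simp: S_def)
  hence eq: "?h R = cyclotomic_complex n * ?h Q"
    using prod_cyclotomic_complex[OF less.prems] by (simp add: hR hQ)
  have "?h R = ?h (R div Q) * ?h Q + ?h (R mod Q)"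
    by (metis div_mult_mod_eq map_poly_of_rat_add map_poly_of_rat_mult)
  hence B: "?h (R mod Q) = (cyclotomic_complex n - ?h (R div Q)) * ?h Q"
    using eq by (simp add: algebra_simps)
  have "cyclotomic_complex n - ?h (R div Q) = 0"
  proof (rule ccontr)
    assume ne: "cyclotomic_complex n - ?h (R div Q) \<noteq> 0"
    have hQ0: "?h Q \<noteq> 0" using Q0 inj_map_poly_of_rat by (metis injD map_poly_0)
    have "degree (R mod Q) = degree (cyclotomic_complex n - ?h (R div Q)) + degree Q"
      using degree_mult_eq[OF ne hQ0] B by (metis degree_map_of_rat)
    moreover have "?h (R mod Q) \<noteq> 0" using B ne hQ0 by simp
    hence "R mod Q \<noteq> 0" by auto
    ultimately show False using degree_mod_less[OF Q0, of R] by simp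
  qed
  thus ?case by (intro exI[of _ "R div Q"]) simp
qed

lemma map_poly_cyclotomic:
  assumes "n > 0"
  shows "map_poly of_rat (cyclotomic n) = cyclotomic_complex n"
proof -
  have "\<exists>!p. map_poly of_rat p = cyclotomic_complex n"
    using rational_cyclotomic[OF assms] inj_map_poly_of_rat by (metis injD)
  thus ?thesis unfolding cyclotomic_def by (rule theI')
qed

end

theory Submission
  imports Defs "HOL-Computational_Algebra.Field_as_Ring"
begin

text \<open>
  With base \<open>p = q^3\<close> and \<open>k = s + j\<close>, the sum is very-well-poised in
  \<open>a = q^(6 s - 1)\<close>, \<open>b = q^(-1)\<close>, \<open>c = q^(3 s - 1)\<close>. The further parameter \<open>d = q^(3 s + 1)\<close> may be
  inserted for free, since its partner is \<open>a p / d = d\<close>, and then \<open>a = b c d\<close>: this is the case in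
  which the sum telescopes. The closed form of the partial sum up to
  \<open>k = s + N\<close> has the numerator factors \<open>(q^(-1); q^3)_m\<close> for
  \<open>m = N + 1, N + s + 1, N + 2 s + 1\<close>. For \<open>N = (2 n + 1) / 3\<close> each of them contains
  \<open>1 - q^(2 n)\<close>, hence a factor \<open>\<Phi>_n\<close>, while the bound on \<open>s\<close> keeps the
  denominator coprime to \<open>\<Phi>_n\<close>.
\<close>

subsection \<open>Cyclotomic polynomials\<close>

lemma map_poly_of_rat_prod:
  "map_poly (of_rat :: rat \<Rightarrow> complex) (\<Prod>x\<in>A. f x) = (\<Prod>x\<in>A. map_poly of_rat (f x))"
  by (induction A rule: infinite_finite_induct) (simp_all add: map_poly_of_rat_mult)

text \<open>The complex factorisation of \<open>X^n - 1\<close> pulls back along the injective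
  embedding of rational polynomials, and \<open>X^n - 1\<close> divides
  \<open>X^(n l) - 1\<close>.\<close>

lemma cyclotomic_dvd:
  assumes "n > 0" "n dvd m"
  shows "cyclotomic n dvd 1 - Polynomial.monom 1 m"
proof -
  obtain l where m: "m = n * l" using assms by auto
  have "map_poly of_rat (\<Prod>d | d dvd n. cyclotomic d) =
      (\<Prod>d | d dvd n. map_poly (of_rat :: rat \<Rightarrow> complex) (cyclotomic d))"
    by (rule map_poly_of_rat_prod)
  also have "\<dots> = (\<Prod>d | d dvd n. cyclotomic_complex d)"
    using assms by (intro prod.cong refl map_poly_cyclotomic) (simp add: dvd_pos_nat)
  also have "\<dots> = map_poly of_rat (Polynomial.monom 1 n - 1)"
    unfolding prod_cyclotomic_complex[OF assms(1)]
    by (intro poly_eqI) (auto simp: coeff_map_poly of_rat_diff)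
  finally have "(\<Prod>d | d dvd n. cyclotomic d) = Polynomial.monom 1 n - 1"
    by (rule injD[OF inj_map_poly_of_rat])
  moreover have "cyclotomic n dvd (\<Prod>d | d dvd n. cyclotomic d)"
    using assms(1) by (intro dvd_prodI) simp_all
  ultimately have "cyclotomic n dvd Polynomial.monom 1 n - 1" by simp
  also have "Polynomial.monom 1 n - 1 dvd (Polynomial.monom 1 n :: rat poly) ^ l - 1"
    unfolding power_diff_1_eq by (rule dvd_triv_left)
  also have "(Polynomial.monom 1 n :: rat poly) ^ l = Polynomial.monom 1 m"
    by (simp add: m monom_power)
  finally have "cyclotomic n dvd - (1 - Polynomial.monom 1 m)" by (simp only: minus_diff_eq)
  then show ?thesis by (simp only: dvd_minus_iff)
qed

text \<open>Every root is a power of \<open>cis (2 * pi / real n)\<close> with exponent coprime to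
  \<open>n\<close>, so its multiplicative order is exactly \<open>n\<close>.\<close>

lemma root_cyclotomic_complex:
  assumes "n > 0" "poly (cyclotomic_complex n) z = 0"
  shows "z ^ m = 1 \<longleftrightarrow> n dvd m"
proof -
  obtain k where k: "coprime k n" and z: "z = cis (2 * pi / real n) ^ k"
    using assms by (auto simp: cyclotomic_complex_def poly_prod totatives_def)
  have "z ^ m = cis (2 * pi / real n) ^ (k * m)"
    by (simp add: z power_mult)
  also have "\<dots> = 1 \<longleftrightarrow> n dvd k * m"
  proof
    assume "n dvd k * m"
    then obtain l where "k * m = n * l" by auto
    then show "cis (2 * pi / real n) ^ (k * m) = 1"
      using assms by (simp add: power_mult DeMoivre)
  next
    assume "cis (2 * pi / real n) ^ (k * m) = 1"
    then have "cis (2 * pi * real (k * m) / real n) = 1"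
      by (simp only: cis_power_div)
    \<comment> \<open>The real part suffices: the cosine equals 1 only at integer multiples of 2
      pi.\<close>
    then have "cos (2 * pi * real (k * m) / real n) = 1"
      by (metis cis.simps(1) one_complex.simps(1))
    then obtain i :: int where "2 * pi * real (k * m) / real n = of_int i * 2 * pi"
      unfolding cos_one_2pi_int by blast
    then have "real (k * m) = of_int i * real n"
      using assms by (simp add: field_simps)
    then have "int (k * m) = i * int n"
      by (metis of_int_eq_iff of_int_mult of_int_of_nat_eq)
    then show "n dvd k * m"
      by (metis dvd_triv_right int_dvd_int_iff)
  qed
  also have "\<dots> \<longleftrightarrow> n dvd m"
    using k by (simp add: coprime_commute coprime_dvd_mult_right_iff)
  finally show ?thesis .
qed

text \<open>A common factor of positive degree would have a complex root, and \<open>p\<close> would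
  share this root with the cyclotomic polynomial.\<close>

lemma coprime_cyclotomicI:
  assumes "n > 0" "\<And>z. poly (cyclotomic_complex n) z = 0 \<Longrightarrow> poly (map_poly of_rat p) z \<noteq> 0"
  shows "coprime p (cyclotomic n)"
proof (rule coprimeI)
  fix g assume p: "g dvd p" and c: "g dvd cyclotomic n"
  let ?h = "map_poly (of_rat :: rat \<Rightarrow> complex)"
  have no_root: "poly (?h g) z \<noteq> 0" for z
  proof
    assume z: "poly (?h g) z = 0"
    have "poly (?h r) z = 0" if "g dvd r" for r
      using that z by (auto simp: map_poly_of_rat_mult elim!: dvdE)
    from this[OF p] this[OF c] show False
      using assms map_poly_cyclotomic[OF assms(1)] by auto
  qed
  then have "degree g = 0"
    using fundamental_theorem_of_algebra[of "?h g"]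
    by (metis constant_degree degree_map_of_rat)
  moreover have "g \<noteq> 0" using no_root by auto
  ultimately show "is_unit g" by (simp add: is_unit_iff_degree)
qed

lemma coprime_cyclotomic:
  assumes "n > 0" "\<not> n dvd m"
  shows "coprime (1 - Polynomial.monom 1 m) (cyclotomic n)"
proof (rule coprime_cyclotomicI[OF assms(1)])
  fix z assume "poly (cyclotomic_complex n) z = 0"
  then have "z ^ m \<noteq> 1"
    using root_cyclotomic_complex[OF assms(1)] assms(2) by blast
  moreover have "map_poly of_rat (1 - Polynomial.monom 1 m) = (1 - Polynomial.monom 1 m :: complex poly)"
    by (intro poly_eqI) (auto simp: coeff_map_poly of_rat_diff)
  then have "poly (map_poly of_rat (1 - Polynomial.monom 1 m)) z = 1 - z ^ m"
    by (simp only: poly_diff poly_1 poly_monom mult_1)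
  ultimately show "poly (map_poly of_rat (1 - Polynomial.monom 1 m)) z \<noteq> 0"
    by simp
qed

lemma coprime_X_cyclotomic:
  assumes "n > 0"
  shows "coprime [:0, 1:] (cyclotomic n)"
proof (rule coprime_cyclotomicI[OF assms])
  fix z assume "poly (cyclotomic_complex n) z = 0"
  then have "z ^ n = 1" using root_cyclotomic_complex[OF assms, of z n] by simp
  then have "z \<noteq> 0" using assms by (auto simp: power_0_left)
  then show "poly (map_poly of_rat [:0, 1:]) z \<noteq> 0" by (simp add: map_poly_pCons)
qed


subsection \<open>The localisation of the polynomial ring\<close>

text \<open>A subring of the rational functions, so that denominators can be checked for coprimality
  to \<open>P\<close> factor by factor.\<close>

definition local_ring :: "rat poly \<Rightarrow> ratfun set" where
  "local_ring P = {to_fract N / to_fract D | N D. D \<noteq> 0 \<and> coprime D P}"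

lemma local_ringI: "D \<noteq> 0 \<Longrightarrow> coprime D P \<Longrightarrow> to_fract N / to_fract D \<in> local_ring P"
  unfolding local_ring_def by blast

lemma local_ringE:
  assumes "A \<in> local_ring P"
  obtains N D where "A = to_fract N / to_fract D" "D \<noteq> 0" "coprime D P"
  using assms unfolding local_ring_def by blast

lemma to_fract_in_local_ring: "to_fract N \<in> local_ring P"
  using local_ringI[of 1 P N] by simp

lemma inverse_in_local_ring:
  "D \<noteq> 0 \<Longrightarrow> coprime D P \<Longrightarrow> inverse (to_fract D) \<in> local_ring P"
  using local_ringI[of D P 1] by (simp add: divide_inverse)

lemma mult_in_local_ring:
  assumes "A \<in> local_ring P" "B \<in> local_ring P"
  shows "A * B \<in> local_ring P"
proof -
  obtain N D where A: "A = to_fract N / to_fract D" "D \<noteq> 0" "coprime D P"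
    using assms(1) by (rule local_ringE)
  obtain N' D' where B: "B = to_fract N' / to_fract D'" "D' \<noteq> 0" "coprime D' P"
    using assms(2) by (rule local_ringE)
  have "A * B = to_fract (N * N') / to_fract (D * D')"
    by (simp add: A B)
  also have "\<dots> \<in> local_ring P"
    using A B by (intro local_ringI) (auto simp: coprime_mult_left_iff)
  finally show ?thesis .
qed

lemma diff_in_local_ring:
  assumes "A \<in> local_ring P" "B \<in> local_ring P"
  shows "A - B \<in> local_ring P"
proof -
  obtain N D where A: "A = to_fract N / to_fract D" "D \<noteq> 0" "coprime D P"
    using assms(1) by (rule local_ringE)
  obtain N' D' where B: "B = to_fract N' / to_fract D'" "D' \<noteq> 0" "coprime D' P"
    using assms(2) by (rule local_ringE)
  have "A - B = to_fract (N * D' - N' * D) / to_fract (D * D')"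
    using A B by (simp add: diff_frac_eq to_fract_diff)
  also have "\<dots> \<in> local_ring P"
    using A B by (intro local_ringI) (auto simp: coprime_mult_left_iff)
  finally show ?thesis .
qed

lemma prod_in_local_ring:
  "(\<And>i. i \<in> I \<Longrightarrow> f i \<in> local_ring P) \<Longrightarrow> prod f I \<in> local_ring P"
  using to_fract_in_local_ring[of 1 P]
  by (induction I rule: infinite_finite_induct) (auto intro: mult_in_local_ring)

text \<open>A denominator coprime to \<open>P\<close> is also coprime to \<open>P ^ k\<close>, so
  controlling denominators modulo \<open>P\<close> is enough.\<close>

lemma ratfun_cong_0_powerI:
  assumes "A \<in> local_ring P"
  shows "ratfun_cong_0 (to_fract P ^ k * A) (P ^ k)"
proof -
  obtain N D where "A = to_fract N / to_fract D" "D \<noteq> 0" "coprime D P"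
    using assms by (rule local_ringE)
  moreover have "to_fract P ^ k = to_fract (P ^ k)"
    by (induction k) simp_all
  ultimately have "D \<noteq> 0 \<and> coprime D (P ^ k) \<and>
      to_fract P ^ k * A = to_fract (P ^ k) * to_fract N / to_fract D"
    by simp
  then show ?thesis
    unfolding ratfun_cong_0_def by blast
qed


subsection \<open>Powers of the indeterminate\<close>

lemma qvar_nonzero: "qvar \<noteq> 0"
  by (simp add: qvar_def)

lemma qvar_power: "qvar ^ m = to_fract (Polynomial.monom 1 m)"
  by (induction m) (simp_all add: qvar_def monom_Suc flip: to_fract_mult)

lemma one_minus_qvar_power: "1 - qvar ^ m = to_fract (1 - Polynomial.monom 1 m)"
  by (simp add: qvar_power to_fract_diff)

lemma one_minus_monom_nonzero:
  assumes "m > 0"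
  shows "1 - Polynomial.monom 1 m \<noteq> (0 :: rat poly)"
proof
  assume "1 - Polynomial.monom 1 m = (0 :: rat poly)"
  then have "poly.coeff (1 - Polynomial.monom 1 m) m = (0 :: rat)" by simp
  then show False using assms by simp
qed

lemma one_minus_qvar_power_nonzero: "m > 0 \<Longrightarrow> 1 - qvar ^ m \<noteq> 0"
  using one_minus_monom_nonzero unfolding one_minus_qvar_power to_fract_eq_0_iff .

text \<open>
  The exponent \<open>3 m - 1\<close> is written as \<open>qvar ^ (3 * m) / qvar\<close> because it is negative for \<open>m = 0\<close>.
\<close>

lemma one_minus_qvar_power_divide_nonzero: "1 - qvar ^ (3 * m) / qvar \<noteq> 0"
proof (cases m)
  case 0
  then show ?thesis
    using one_minus_qvar_power_nonzero[of 1] qvar_nonzero by (simp add: field_simps)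
next
  case (Suc k)
  then have "qvar ^ (3 * m) / qvar = qvar ^ (3 * k + 2)"
    using qvar_nonzero by (simp add: field_simps power_add eval_nat_numeral)
  then show ?thesis using one_minus_qvar_power_nonzero[of "3 * k + 2"] by simp
qed

lemma inverse_one_minus_qvar_power_in_local_ring:
  assumes "n > 0" "\<not> n dvd m"
  shows "inverse (1 - qvar ^ m) \<in> local_ring (cyclotomic n)"
  unfolding one_minus_qvar_power using assms
  by (intro inverse_in_local_ring coprime_cyclotomic one_minus_monom_nonzero) (auto intro: Nat.gr0I)

lemma inverse_qvar_in_local_ring: "n > 0 \<Longrightarrow> inverse qvar \<in> local_ring (cyclotomic n)"
  unfolding qvar_def by (intro inverse_in_local_ring coprime_X_cyclotomic) auto

text \<open>For \<open>m > 0\<close> the exponent \<open>3 m - 1\<close> lies strictly between 0 and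
  \<open>n\<close>. For \<open>m = 0\<close> the element is \<open>q / (q - 1)\<close>, whose
  denominator is harmless because \<open>n > 1\<close>.\<close>

lemma inverse_one_minus_qvar_power_divide_in_local_ring:
  assumes "n > 1" "3 * m < n"
  shows "inverse (1 - qvar ^ (3 * m) / qvar) \<in> local_ring (cyclotomic n)"
proof (cases m)
  case 0
  have "inverse (1 - qvar ^ (3 * m) / qvar) = (to_fract 0 - qvar ^ 1) * inverse (1 - qvar ^ 1)"
    using 0 one_minus_qvar_power_nonzero[of 1] one_minus_qvar_power_divide_nonzero[of 0] qvar_nonzero
    by (simp add: field_simps)
  also have "\<dots> \<in> local_ring (cyclotomic n)"
    using assms
    by (intro mult_in_local_ring diff_in_local_ring inverse_one_minus_qvar_power_in_local_ring)
       (auto simp: qvar_def simp flip: to_fract_0 intro: to_fract_in_local_ring)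
  finally show ?thesis .
next
  case (Suc k)
  then have "qvar ^ (3 * m) / qvar = qvar ^ (3 * k + 2)"
    using qvar_nonzero by (simp add: field_simps power_add eval_nat_numeral)
  moreover have "\<not> n dvd 3 * k + 2" using Suc assms by (auto dest: dvd_imp_le)
  ultimately show ?thesis
    using inverse_one_minus_qvar_power_in_local_ring[of n "3 * k + 2"] assms by simp
qed


subsection \<open>The shifted factorials\<close>

lemma q3_poch_Suc: "q3_poch x (Suc m) = q3_poch x m * (1 - x * qvar ^ (3 * m))"
  by (simp add: q3_poch_def)

lemma q3_poch_cube_nonzero: "q3_poch (qvar ^ 3) m \<noteq> 0"
  using one_minus_qvar_power_nonzero by (simp add: q3_poch_def prod_zero_iff flip: power_add)

text \<open>The factors are \<open>1 - q^(3 i)\<close> with \<open>i\<close> from 1 to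
  \<open>m\<close>. As 3 is invertible modulo \<open>n\<close>, \<open>n\<close> divides
  \<open>3 i\<close> only if it divides \<open>i\<close>, which \<open>m < n\<close>
  excludes.\<close>

lemma inverse_q3_poch_cube_in_local_ring:
  assumes "coprime n 3" "m < n"
  shows "inverse (q3_poch (qvar ^ 3) m) \<in> local_ring (cyclotomic n)"
proof -
  have "\<not> n dvd 3 + 3 * j" if "j < m" for j
  proof -
    have "n dvd 3 * Suc j \<longleftrightarrow> n dvd Suc j"
      using assms(1) by (rule coprime_dvd_mult_right_iff)
    then show ?thesis using that assms by (auto dest: dvd_imp_le)
  qed
  then have "(\<Prod>j<m. inverse (1 - qvar ^ (3 + 3 * j))) \<in> local_ring (cyclotomic n)"
    using assms by (intro prod_in_local_ring inverse_one_minus_qvar_power_in_local_ring) auto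
  then show ?thesis by (simp add: q3_poch_def prod_inversef[unfolded comp_def] power_add)
qed

text \<open>The factor with index \<open>j\<close> has exponent \<open>3 j - 1 = l\<close> and so
  contains the cyclotomic polynomial; the others have at worst the denominator \<open>q\<close>,
  which is coprime to it.\<close>

lemma q3_poch_inverse_cyclotomic_multiple:
  assumes "n > 0" "n dvd l" "3 * j = l + 1" "j < m"
  obtains A where "A \<in> local_ring (cyclotomic n)"
    "q3_poch (inverse qvar) m = to_fract (cyclotomic n) * A"
proof -
  obtain R where R: "1 - Polynomial.monom 1 l = cyclotomic n * R"
    using cyclotomic_dvd[OF assms(1,2)] by (elim dvdE)
  define B where "B = (\<Prod>i\<in>{..<m} - {j}. 1 - inverse qvar * qvar ^ (3 * i))"
  have "B \<in> local_ring (cyclotomic n)"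
    unfolding B_def one_minus_qvar_power
    using inverse_qvar_in_local_ring[OF assms(1)] to_fract_in_local_ring[of 1]
    by (intro prod_in_local_ring diff_in_local_ring mult_in_local_ring)
       (auto simp: qvar_power intro: to_fract_in_local_ring)
  moreover have "1 - inverse qvar * qvar ^ (3 * j) = 1 - qvar ^ l"
    using qvar_nonzero by (simp add: assms(3))
  then have "q3_poch (inverse qvar) m = (1 - qvar ^ l) * B"
    unfolding q3_poch_def B_def using assms(4) by (subst prod.remove[of _ j]) auto
  then have "q3_poch (inverse qvar) m = to_fract (cyclotomic n) * (to_fract R * B)"
    by (simp add: one_minus_qvar_power R mult.assoc)
  ultimately show ?thesis
    using that to_fract_in_local_ring mult_in_local_ring by blast
qed


subsection \<open>Telescoping\<close>

text \<open>
  For \<open>x = q^(3 N)\<close> and \<open>y = q^(3 s)\<close>, this compares two consecutive closed forms after their common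
  factors are cancelled.
\<close>

lemma telescoping_identity:
  fixes q x y :: "'a :: field"
  assumes "q \<noteq> 0"
  shows "(1 - q ^ 4 * x * y) * (1 - q ^ 2 * x) * (1 - q ^ 2 * x * y ^ 2) * (1 - q ^ 2 * x * y)
      - (1 - q * x * y) * (1 - q ^ 3 * x) * (1 - q ^ 3 * x * y ^ 2) * (1 - q ^ 3 * x * y)
    = (1 - q ^ 5 * x ^ 2 * y ^ 2) * (q ^ 3 * x) * ((1 - q * y) * (1 - y / q) * (1 - 1 / q))"
proof -
  \<comment> \<open>Clearing the denominators leaves a polynomial identity, verified by
    expansion.\<close>
  have "q ^ 3 * x * ((1 - q * y) * (1 - y / q) * (1 - 1 / q)) =
      q * x * ((1 - q * y) * (q - y) * (q - 1))"
    using assms by (simp add: field_simps power3_eq_cube)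
  then show ?thesis
    unfolding mult.assoc[of _ "q ^ 3 * x"]
    by (simp only:) (simp add: algebra_simps eval_nat_numeral)
qed

lemma q_int_6: "q_int (6 * int k - 1) = (1 - qvar ^ (6 * k) / qvar) / (1 - qvar)"
proof -
  have "qvar powi (6 * int k - 1) = qvar ^ (6 * k) / qvar"
    using qvar_nonzero power_int_of_nat[of qvar "6 * k"] by (simp add: power_int_diff)
  then show ?thesis by (simp add: q_int_def)
qed

text \<open>Induction on \<open>N\<close>: by \<open>telescoping_identity\<close>, consecutive
  closed forms differ by exactly the new summand.\<close>

lemma sum_closed_form:
  defines "P \<equiv> q3_poch (inverse qvar)" and "Q \<equiv> q3_poch (qvar ^ 3)"
  shows "(\<Sum>k = s..N + s. q_int (6 * int k - 1) *
      ((P (k - s) * P (k + s) * P k) / (Q (k - s) * Q (k + s) * Q k)) * qvar ^ (3 * k)) =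
    qvar ^ (3 * s) * (1 - qvar ^ (3 * s + 3 * N + 1)) *
      (P (N + 1) * P (N + 2 * s + 1) * P (N + s + 1)) /
      ((1 - qvar) * (1 - qvar ^ (3 * s + 1)) * (1 - qvar ^ (3 * s) / qvar) * (1 - 1 / qvar) *
       (Q N * Q (N + 2 * s) * Q (N + s)))"
proof -
  define y where "y = qvar ^ (3 * s)"
  \<comment> \<open>Apart from \<open>1 - qvar\<close>, this is the part of the denominator that
    does not change with \<open>N\<close>.\<close>
  define c where "c = (1 - qvar * y) * (1 - y / qvar) * (1 - 1 / qvar)"
  have q0: "qvar \<noteq> 0" and q1: "1 - qvar \<noteq> 0"
    using qvar_nonzero one_minus_qvar_power_nonzero[of 1] by auto
  have c0: "1 - qvar * y \<noteq> 0" "1 - y / qvar \<noteq> 0" "1 - 1 / qvar \<noteq> 0"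
    using one_minus_qvar_power_nonzero[of "3 * s + 1"] one_minus_qvar_power_divide_nonzero[of s]
      one_minus_qvar_power_divide_nonzero[of 0] by (simp_all add: y_def)
  then have "c \<noteq> 0" by (simp add: c_def)
  have P: "P (Suc m) = P m * (1 - qvar ^ (3 * m) / qvar)"
    and Q: "Q (Suc m) = Q m * (1 - qvar ^ 3 * qvar ^ (3 * m))" and Q0: "Q m \<noteq> 0" for m
    using q3_poch_cube_nonzero by (auto simp: P_def Q_def q3_poch_Suc divide_inverse mult.commute)
  have "(\<Sum>k = s..N + s. q_int (6 * int k - 1) *
      ((P (k - s) * P (k + s) * P k) / (Q (k - s) * Q (k + s) * Q k)) * qvar ^ (3 * k)) =
    y * (1 - qvar * qvar ^ (3 * N) * y) * (P (Suc N) * P (Suc (N + 2 * s)) * P (Suc (N + s))) /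
      ((1 - qvar) * c * (Q N * Q (N + 2 * s) * Q (N + s)))" (is "?S N = ?C N")
  proof (induction N)
    case 0
    have P1: "P (Suc 0) = 1 - 1 / qvar" and Q00: "Q 0 = 1" and P0: "P 0 = 1"
      by (simp_all add: P_def Q_def q3_poch_def divide_inverse)
    have "6 * s = 3 * (2 * s)" by simp
    then have "?S 0 = (1 - qvar ^ (3 * (2 * s)) / qvar) / (1 - qvar) *
        (P (2 * s) * P s / (Q (2 * s) * Q s)) * y"
      by (simp add: q_int_6 P0 Q00 y_def mult_2)
    moreover have "?C 0 = (1 - qvar ^ (3 * (2 * s)) / qvar) / (1 - qvar) *
        (P (2 * s) * P s / (Q (2 * s) * Q s)) * y"
    proof -
      \<comment> \<open>Here \<open>t\<close>, \<open>u\<close>, \<open>v\<close> are the factors of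
        \<open>c\<close>: \<open>t\<close> cancels the linear factor, \<open>u\<close> and
        \<open>v\<close> the last factors of \<open>P (Suc s)\<close> and \<open>P (Suc 0)\<close>.
        The last factor \<open>w\<close> of \<open>P (Suc (2 * s))\<close> survives as the numerator
        of \<open>q_int (6 * int s - 1)\<close>.\<close>
      have "y * t * (v * (p * w) * (p' * u)) / (r * (t * u * v) * (1 * m * m')) =
          w / r * (p * p' / (m * m')) * y"
        if "t \<noteq> 0" "u \<noteq> 0" "v \<noteq> 0" for t u v w r p p' m m'
        using that by simp
      from this[OF c0] show ?thesis
        unfolding c_def add_0 P1 unfolding P Q00 y_def[symmetric] by simp
    qed
    ultimately show ?case by simp
  next
    case (Suc N)
    define x where "x = qvar ^ (3 * N)"
    define A where "A = P (Suc N) * P (Suc (N + 2 * s)) * P (Suc (N + s))"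
    define B where "B = Q N * Q (N + 2 * s) * Q (N + s)"
    \<comment> \<open>When \<open>N\<close> increases by 1, the denominator product \<open>B\<close>
      is multiplied by \<open>d\<close> and the numerator product \<open>A\<close> by
      \<open>e\<close>.\<close>
    define d where "d = (1 - qvar ^ 3 * x) * (1 - qvar ^ 3 * x * y ^ 2) * (1 - qvar ^ 3 * x * y)"
    define e where "e = (1 - qvar ^ 2 * x) * (1 - qvar ^ 2 * x * y ^ 2) * (1 - qvar ^ 2 * x * y)"
    have QQ: "Q (Suc N) * Q (Suc (N + 2 * s)) * Q (Suc (N + s)) = B * d"
      unfolding Q B_def d_def x_def y_def by (simp add: algebra_simps flip: power_add power_mult)
    \<comment> \<open>The numerator lengths are one ahead of the denominator lengths, so the new
      numerator factors have exponents \<open>3 (m + 1) - 1 = 3 m + 2\<close>.\<close>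
    have pow: "qvar ^ (3 * Suc m) / qvar = qvar ^ 2 * qvar ^ (3 * m)" for m
      using q0 by (simp add: field_simps power_add eval_nat_numeral)
    have PP: "P (Suc (Suc N)) * P (Suc (Suc (N + 2 * s))) * P (Suc (Suc (N + s))) = A * e"
      unfolding P[of "Suc _"] pow A_def e_def x_def y_def
      by (simp add: algebra_simps flip: power_add power_mult)
    have BD: "B \<noteq> 0" "d \<noteq> 0"
      using QQ Q0[of "Suc N"] Q0[of "Suc (N + 2 * s)"] Q0[of "Suc (N + s)"] by auto
    have exp5: "qvar ^ (6 * (Suc N + s)) / qvar = qvar ^ 5 * x ^ 2 * y ^ 2"
    proof -
      have "6 * (Suc N + s) = Suc (5 + 3 * N * 2 + 3 * s * 2)" by simp
      then have "qvar ^ (6 * (Suc N + s)) = qvar * (qvar ^ 5 * x ^ 2 * y ^ 2)"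
        unfolding x_def y_def by (simp only: power_Suc power_add power_mult)
      then show ?thesis using q0 by simp
    qed
    have exp3: "qvar ^ (3 * (Suc N + s)) = qvar ^ 3 * x * y"
      by (simp add: x_def y_def algebra_simps flip: power_add)
    have xS: "qvar ^ (3 * Suc N) = qvar ^ 3 * x"
      by (simp add: x_def flip: power_add)
    have ar: "Suc N + s - s = Suc N" "Suc N + s + s = Suc (N + 2 * s)" "Suc N + s = Suc (N + s)"
      "Suc N + 2 * s = Suc (N + 2 * s)" by simp_all
    define k where "k = Suc N + s"
    have "?S (Suc N) = ?S N + q_int (6 * int k - 1) *
      ((P (k - s) * P (k + s) * P k) / (Q (k - s) * Q (k + s) * Q k)) * qvar ^ (3 * k)"
      unfolding k_def by simp
    also have "q_int (6 * int k - 1) *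
      ((P (k - s) * P (k + s) * P k) / (Q (k - s) * Q (k + s) * Q k)) * qvar ^ (3 * k) =
      (1 - qvar ^ 5 * x ^ 2 * y ^ 2) / (1 - qvar) * (A / (B * d)) * (qvar ^ 3 * x * y)"
      unfolding q_int_6 k_def exp5 exp3 unfolding ar(1,2) unfolding ar(3) QQ A_def ..
    also have "?S N = y * (1 - qvar * x * y) * A / ((1 - qvar) * c * B)"
      unfolding Suc.IH A_def B_def x_def ..
    also have "y * (1 - qvar * x * y) * A / ((1 - qvar) * c * B) +
        (1 - qvar ^ 5 * x ^ 2 * y ^ 2) / (1 - qvar) * (A / (B * d)) * (qvar ^ 3 * x * y) =
      y * A * ((1 - qvar * x * y) * d + (1 - qvar ^ 5 * x ^ 2 * y ^ 2) * (qvar ^ 3 * x) * c) /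
        ((1 - qvar) * c * (B * d))"
    proof -
      have "y * u * A / (r * c * B) + v / r * (A / (B * d)) * (w * y) =
          y * A * (u * d + v * w * c) / (r * c * (B * d))" if "r \<noteq> 0" for u v w r
        using that BD \<open>c \<noteq> 0\<close> by (simp add: field_simps)
      from this[OF q1] show ?thesis .
    qed
    \<comment> \<open>The subtracted product of \<open>telescoping_identity\<close>, moved to the
      other side, is the contribution of the old closed form.\<close>
    also have "(1 - qvar * x * y) * d + (1 - qvar ^ 5 * x ^ 2 * y ^ 2) * (qvar ^ 3 * x) * c =
        (1 - qvar ^ 4 * x * y) * e"
      using telescoping_identity[OF q0, of x y] unfolding c_def d_def e_def
      by (simp only: mult.assoc diff_eq_eq add.commute)
    also have "y * A * ((1 - qvar ^ 4 * x * y) * e) / ((1 - qvar) * c * (B * d)) = ?C (Suc N)"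
    proof -
      \<comment> \<open>The linear factor of \<open>?C (Suc N)\<close> has
        \<open>qvar ^ 3 * x\<close> in place of \<open>x\<close>.\<close>
      have "qvar * (qvar ^ 3 * x) = qvar ^ 4 * x" by (simp add: eval_nat_numeral)
      then show ?thesis
        unfolding xS ar(3,4) QQ PP by (simp only: mult_ac)
    qed
    finally show ?case .
  qed
  moreover have "qvar ^ (3 * s + 3 * N + 1) = qvar * qvar ^ (3 * N) * y" "qvar ^ (3 * s + 1) = qvar * y"
    by (simp_all add: y_def power_add)
  ultimately show ?thesis
    by (simp only: c_def y_def[symmetric] mult.assoc Suc_eq_plus1)
qed

section \<open>Divisibility of the closed form by the cube of the cyclotomic polynomial\<close>

theorem theorem1p3:
  fixes n s :: nat
  assumes "n > 1"
    and "[n = 1] (mod 3)"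
    and "real s \<le> (real n - 4) / 6"
  shows "ratfun_cong_0
    (\<Sum>k = s..(2 * n + 1) div 3 + s.
       q_int (6 * int k - 1) *
       ((q3_poch (inverse qvar) (k - s) * q3_poch (inverse qvar) (k + s) * q3_poch (inverse qvar) k) /
        (q3_poch (qvar ^ 3) (k - s) * q3_poch (qvar ^ 3) (k + s) * q3_poch (qvar ^ 3) k)) *
       qvar ^ (3 * k))
    (cyclotomic n ^ 3)"
proof -
  let ?P = "q3_poch (inverse qvar)" and ?Q = "q3_poch (qvar ^ 3)" and ?R = "local_ring (cyclotomic n)"
  define M where "M = (2 * n + 1) div 3"
  have "real (6 * s + 4) \<le> real n" using assms(3) by simp
  then have s: "6 * s + 4 \<le> n" by (simp only: of_nat_le_iff)
  have n3: "n mod 3 = 1" using assms(2) by (simp add: cong_def)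
  \<comment> \<open>The division is exact, so the factor with index \<open>M\<close> in
    \<open>?P\<close> is \<open>1 - q^(2 n)\<close>.\<close>
  then have M: "3 * M = 2 * n + 1" unfolding M_def by presburger
  have "coprime n 3"
    using n3 by (metis coprime_mod_left_iff coprime_1_left zero_neq_numeral)
  have "n > 0" using assms(1) by simp
  \<comment> \<open>\<open>?P (M + 1)\<close> is the shortest product containing the index
    \<open>M\<close>, so the \<open>+ 1\<close> in the closed form is just enough.\<close>
  obtain A where A: "A \<in> ?R" "?P (M + 1) = to_fract (cyclotomic n) * A"
    using q3_poch_inverse_cyclotomic_multiple[OF \<open>n > 0\<close> _ M, of "M + 1"] by auto
  obtain B where B: "B \<in> ?R" "?P (M + 2 * s + 1) = to_fract (cyclotomic n) * B"
    using q3_poch_inverse_cyclotomic_multiple[OF \<open>n > 0\<close> _ M, of "M + 2 * s + 1"] by auto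
  obtain C where C: "C \<in> ?R" "?P (M + s + 1) = to_fract (cyclotomic n) * C"
    using q3_poch_inverse_cyclotomic_multiple[OF \<open>n > 0\<close> _ M, of "M + s + 1"] by auto
  \<comment> \<open>The closed form without its three cyclotomic factors; the exponents
    \<open>1\<close> and \<open>3 * 0\<close> give \<open>1 - qvar\<close> and
    \<open>1 - 1 / qvar\<close> the shape of the membership lemmas.\<close>
  define E where "E = to_fract (Polynomial.monom 1 (3 * s)) * to_fract (1 - Polynomial.monom 1 (3 * s + 3 * M + 1)) * (A * B * C) *
    inverse (1 - qvar ^ 1) * inverse (1 - qvar ^ (3 * s + 1)) * inverse (1 - qvar ^ (3 * s) / qvar) *
    inverse (1 - qvar ^ (3 * 0) / qvar) * inverse (?Q M) * inverse (?Q (M + 2 * s)) * inverse (?Q (M + s))"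
  have "\<not> n dvd 3 * s + 1" "\<not> n dvd 1" using s assms(1) by (auto dest: dvd_imp_le)
  \<comment> \<open>The bound on \<open>s\<close> gives
    \<open>3 (M + 2 s) = 2 n + 1 + 6 s \<le> 3 n - 3\<close>.\<close>
  moreover have "M < n" "M + 2 * s < n" "M + s < n" using M s by auto
  ultimately have "E \<in> ?R"
    unfolding E_def using A(1) B(1) C(1) assms(1) s \<open>coprime n 3\<close>
    by (intro mult_in_local_ring to_fract_in_local_ring inverse_one_minus_qvar_power_in_local_ring
        inverse_one_minus_qvar_power_divide_in_local_ring inverse_q3_poch_cube_in_local_ring) auto
  then have "ratfun_cong_0 (to_fract (cyclotomic n) ^ 3 * E) (cyclotomic n ^ 3)"
    by (rule ratfun_cong_0_powerI)
  also have "to_fract (cyclotomic n) ^ 3 * E = qvar ^ (3 * s) * (1 - qvar ^ (3 * s + 3 * M + 1)) *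
      (?P (M + 1) * ?P (M + 2 * s + 1) * ?P (M + s + 1)) /
      ((1 - qvar) * (1 - qvar ^ (3 * s + 1)) * (1 - qvar ^ (3 * s) / qvar) * (1 - 1 / qvar) *
       (?Q M * ?Q (M + 2 * s) * ?Q (M + s)))"
    unfolding E_def A(2) B(2) C(2) one_minus_qvar_power[symmetric] qvar_power[symmetric]
    by (simp add: divide_inverse inverse_mult_distrib power3_eq_cube mult_ac)
  finally show ?thesis
    unfolding sum_closed_form M_def .
qed

end
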